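(* Let $L\ge\mu>0$, let $h:\mathbb{R}^n\to\mathbb{R}$ be $L$-smooth and $\mu$-strongly convex, let $\psi:\mathbb{R}^n\to\mathbb{R}\cup\{+\infty\}$ be proper, convex and lower semicontinuous, and let $f=h+\psi$, with unique minimizer $x^*$ and optimal value $f^*=f(x^* )$. Let $(\mu_i)_{i\in\mathbb{N}}$ be a non-increasing sequence of positive reals with $\mu_1<L$ satisfying $$0\le \mu_k-\mu\le \frac{C}{(k+1)^2}\qquad\text{for all } k\ge 1,$$ where $C$ is a constant with $$C\le \frac{\mu\left(1-\sqrt{\mu_0/L}\right)}{3\sqrt{\mu_0/L}}.$$ Let $x_0\in\mathbb{R}^n$ and let $(y_k)_{k\ge0}$ and $(A_k)_{k\ge 0}$ be produced by Algorithm AdaptAPG (defined in the context) with inputs $x_0$, $L$, $(\mu_i)_{i\in\mathbb{N}}$. Then $$f(y_k)-f^*\le \frac{5C_0}{2A_k}\qquad\text{for all } k\ge 0,$$ where $$C_0=\max\left((\mu_0-\mu)\|x_0-x^*\|^2,\; 2(f(x_0)-f^* )+\mu\|x_0-x^*\|^2\right),$$ and $$A_k\ge\left(1-\sqrt{\frac{\mu}{L}}\right)^{-k}\qquad\text{for all } k\ge 1.$$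
   Context: $\|\cdot\|$ is the Euclidean norm. A function $h$ is $L$-smooth if it is differentiable with $L$-Lipschitz gradient. For $y\in\mathbb{R}^n$ define $$T_L(y)=\operatorname{argmin}_{x\in\mathbb{R}^n}\; h(y)+\nabla h(y)^T(x-y)+\frac{L}{2}\|x-y\|^2+\psi(x),\qquad g_L(y)=L\,(y-T_L(y)).$$ Inequalities involving $f(x_0)$ are understood in $(-\infty,+\infty]$. Algorithm AdaptAPG (inputs $x_0\in\mathbb{R}^n$, $L$, and a sequence $(\mu_i)_{i\in\mathbb{N}}$). Set $A_0=1$, $a_0=1$, $y_0=x_0$, and let $m_0$ be the constant function $m_0(x)=a_0f^*$. For $k=0,1,2,\dots$: - $\kappa_k=\mu_{k+1}/L$; - $v_k=\operatorname{argmin}_{x\in\mathbb{R}^n}\; m_k(x)+\frac{a_0\mu_0}{2}\|x-x_0\|^2$; - $a_{k+1}=\frac{\sqrt{\kappa_k}}{1-\sqrt{\kappa_k}}A_k$, $A_{k+1}=A_k+a_{k+1}$, $\tau_k=a_{k+1}/A_{k+1}$; - $x_{k+1}=\frac{\tau_k}{1+\tau_k}v_k+\frac{1}{1+\tau_k}y_k$; - $y_{k+1}=T_L(x_{k+1})$; - $l_L(x,x_{k+1})=f(T_L(x_{k+1}))+g_L(x_{k+1})^T(x-x_{k+1})+\frac{1}{2L}\|g_L(x_{k+1})\|^2$; - $m_{k+1}(x)=m_k(x)+a_{k+1}\left(l_L(x,x_{k+1})+\frac{\mu_{k+1}}{2}\|x-x_{k+1}\|^2\right)$. *)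

theory Defs
  imports "HOL-Analysis.Analysis"
begin

definition grad :: "('a::euclidean_space \<Rightarrow> real) \<Rightarrow> 'a \<Rightarrow> 'a" where
  "grad h x = (THE D. GDERIV h x :> D)"

definition L_smooth :: "real \<Rightarrow> ('a::euclidean_space \<Rightarrow> real) \<Rightarrow> bool" where
  "L_smooth L h \<longleftrightarrow> (\<forall>x. h differentiable (at x)) \<and> L-lipschitz_on UNIV (grad h)"

definition strongly_convex :: "real \<Rightarrow> ('a::euclidean_space \<Rightarrow> real) \<Rightarrow> bool" where
  "strongly_convex mu h \<longleftrightarrow> convex_on UNIV (\<lambda>x. h x - mu / 2 * (norm x)\<^sup>2)"

text \<open>
  Extended-valued functions on the whole space, with values in $(-\infty,+\infty]$. Convexity is
  stated for interior weights only, so that no convention for $0\cdot\infty$ enters.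
\<close>

definition proper_ext :: "('a \<Rightarrow> ereal) \<Rightarrow> bool" where
  "proper_ext psi \<longleftrightarrow> (\<forall>x. psi x \<noteq> -\<infinity>) \<and> (\<exists>x. psi x \<noteq> \<infinity>)"

definition convex_ext :: "('a::real_vector \<Rightarrow> ereal) \<Rightarrow> bool" where
  "convex_ext psi \<longleftrightarrow>
     (\<forall>x y t. 0 < t \<and> t < 1 \<longrightarrow>
        psi ((1 - t) *\<^sub>R x + t *\<^sub>R y) \<le> ereal (1 - t) * psi x + ereal t * psi y)"

definition lsc_ext :: "('a::topological_space \<Rightarrow> ereal) \<Rightarrow> bool" where
  "lsc_ext psi \<longleftrightarrow> (\<forall>x. psi x \<le> Liminf (at x) psi)"

definition composite :: "('a \<Rightarrow> real) \<Rightarrow> ('a \<Rightarrow> ereal) \<Rightarrow> 'a \<Rightarrow> ereal" where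
  "composite h psi x = ereal (h x) + psi x"

definition T_step ::
  "real \<Rightarrow> ('a::euclidean_space \<Rightarrow> real) \<Rightarrow> ('a \<Rightarrow> ereal) \<Rightarrow> 'a \<Rightarrow> 'a" where
  "T_step L h psi y =
     arg_min (\<lambda>x. ereal (h y + grad h y \<bullet> (x - y) + L / 2 * (norm (x - y))\<^sup>2) + psi x) (\<lambda>_. True)"

definition g_map ::
  "real \<Rightarrow> ('a::euclidean_space \<Rightarrow> real) \<Rightarrow> ('a \<Rightarrow> ereal) \<Rightarrow> 'a \<Rightarrow> 'a" where
  "g_map L h psi y = L *\<^sub>R (y - T_step L h psi y)"

text \<open>
  The points produced by \<open>T_step\<close> lie in the domain of \<open>psi\<close>, so the objective value below is
  finite and \<open>real_of_ereal\<close> loses nothing. The same holds for the optimal value in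
  \<open>adapt_apg\<close>.
\<close>

definition l_model ::
  "real \<Rightarrow> ('a::euclidean_space \<Rightarrow> real) \<Rightarrow> ('a \<Rightarrow> ereal) \<Rightarrow> 'a \<Rightarrow> 'a \<Rightarrow> real" where
  "l_model L h psi x z =
     real_of_ereal (composite h psi (T_step L h psi z))
       + g_map L h psi z \<bullet> (x - z) + 1 / (2 * L) * (norm (g_map L h psi z))\<^sup>2"

text \<open>
  A run of the algorithm, as the system of recurrences satisfied by all its sequences;
  \<open>x0\<close>, \<open>L\<close> and \<open>mus\<close> determine the run uniquely (up to the index-0 value of \<open>x\<close>, which is
  set to \<open>x0\<close>). The real number \<open>fstar\<close> is the optimal value, used only by the constant
  initial model \<open>m 0\<close>.
\<close>

definition adapt_apg ::
  "('a::euclidean_space \<Rightarrow> real) \<Rightarrow> ('a \<Rightarrow> ereal) \<Rightarrow> real \<Rightarrow> 'a \<Rightarrow> real \<Rightarrow> (nat \<Rightarrow> real) \<Rightarrow>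
   (nat \<Rightarrow> real) \<Rightarrow> (nat \<Rightarrow> 'a) \<Rightarrow> (nat \<Rightarrow> real) \<Rightarrow> (nat \<Rightarrow> real) \<Rightarrow> (nat \<Rightarrow> real) \<Rightarrow>
   (nat \<Rightarrow> 'a) \<Rightarrow> (nat \<Rightarrow> 'a) \<Rightarrow> (nat \<Rightarrow> 'a \<Rightarrow> real) \<Rightarrow> bool" where
  "adapt_apg h psi fstar x0 L mus kappa v a A tau x y m \<longleftrightarrow>
     A 0 = 1 \<and> a 0 = 1 \<and> x 0 = x0 \<and> y 0 = x0 \<and> m 0 = (\<lambda>_. a 0 * fstar) \<and>
     (\<forall>k.
        kappa k = mus (Suc k) / L \<and>
        v k = arg_min (\<lambda>z. m k z + a 0 * mus 0 / 2 * (norm (z - x0))\<^sup>2) (\<lambda>_. True) \<and>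
        a (Suc k) = sqrt (kappa k) / (1 - sqrt (kappa k)) * A k \<and>
        A (Suc k) = A k + a (Suc k) \<and>
        tau k = a (Suc k) / A (Suc k) \<and>
        x (Suc k) = (tau k / (1 + tau k)) *\<^sub>R v k + (1 / (1 + tau k)) *\<^sub>R y k \<and>
        y (Suc k) = T_step L h psi (x (Suc k)) \<and>
        m (Suc k) = (\<lambda>z. m k z + a (Suc k) *
          (l_model L h psi z (x (Suc k)) + mus (Suc k) / 2 * (norm (z - x (Suc k)))\<^sup>2)))"

end

theory Submission imports Defs begin

text \<open>
  The models \<open>m k\<close> are built with curvatures \<open>mus k\<close> that may exceed the true strong convexity
  constant \<open>mu\<close>, so they need not lie below \<open>f\<close>. The argument runs the estimate sequence method
  with these models and shows that the damage is summable.

  One step of \<open>T_step\<close> at \<open>z\<close> yields the minorant \<open>l_model L h psi u z + mu / 2 * (norm (u - z))\<^sup>2\<close>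
  of \<open>f\<close> (\<open>l_model_lower_bound\<close>). Let \<open>phi k\<close> be \<open>m k\<close> plus the initial quadratic; it is a
  quadratic with Hessian \<open>sigma k \<ge> mus k * A k\<close> and minimizer \<open>v k\<close>. The choice of \<open>x\<close> and \<open>a\<close>
  completes a square (\<open>momentum_step_nonneg\<close>), which gives
  \<open>A k * F (y k) - (F x0 - F xstar) \<le> phi k (v k)\<close> (\<open>estimate_sequence\<close>).
  On the other side, the model is evaluated at the minimizer:
  \<open>phi k xstar \<le> A k * F xstar + mus 0 / 2 * (norm (x0 - xstar))\<^sup>2 + err k\<close>, where \<open>err k\<close>
  collects the excess curvatures times the squared distances from the \<open>x i\<close> to \<open>xstar\<close>. Hence
  \<open>potential k = A k * (F (y k) - F xstar) + sigma k / 2 * (norm (v k - xstar))\<^sup>2\<close> is at most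
  \<open>start_gap + err k\<close>.

  The loop closes because the potential controls those distances: \<open>x (Suc k)\<close> is a convex
  combination of \<open>v k\<close> and \<open>y k\<close>, the potential contains the distance of \<open>v k\<close> explicitly, and
  strong convexity turns the objective gap at \<open>y k\<close> into a distance. The condition on \<open>C\<close> makes
  each increment of \<open>err\<close> at most \<open>potential k / (3 * (real k + 2)\<^sup>2)\<close>, so a discrete Gronwall
  argument bounds the potential by twice its initial bound (\<open>err_bounded\<close>). That initial bound is
  the mean of the two quantities under the maximum in \<open>C0\<close>, hence at most \<open>C0\<close>, and twice \<open>C0\<close>
  is within the asserted \<open>5 / 2\<close> of it.
\<close>

section \<open>Gradients, smoothness and strong convexity\<close>

lemma DERIV_along_line:
  fixes G :: "'a::euclidean_space \<Rightarrow> real"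
  assumes "GDERIV G (x + t *\<^sub>R d) :> D"
  shows "((\<lambda>s. G (x + s *\<^sub>R d)) has_real_derivative D \<bullet> d) (at t)"
proof -
  have "((\<lambda>s. x + s *\<^sub>R d) has_derivative (\<lambda>s. s *\<^sub>R d)) (at t)"
    by (auto intro!: derivative_eq_intros)
  moreover have "(G has_derivative (\<lambda>u. u \<bullet> D)) (at (x + t *\<^sub>R d))"
    using assms by (simp add: gderiv_def)
  ultimately have "((\<lambda>s. G (x + s *\<^sub>R d)) has_derivative (\<lambda>s. (s *\<^sub>R d) \<bullet> D)) (at t)"
    by (rule has_derivative_compose)
  then show ?thesis
    by (simp add: has_field_derivative_def inner_commute mult.commute[of _ "D \<bullet> d"])
qed

text \<open>
  The difference quotients of \<open>G\<close> in direction \<open>d\<close> are at least \<open>c\<close>, so their limit is. Both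
  tangent inequalities for convex functions and first-order optimality conditions are instances.
\<close>

lemma gderiv_inner_ge:
  fixes G :: "'a::euclidean_space \<Rightarrow> real"
  assumes G: "GDERIV G x :> D"
    and le: "\<And>t. 0 < t \<Longrightarrow> t < 1 \<Longrightarrow> t * c \<le> G (x + t *\<^sub>R d) - G x"
  shows "c \<le> D \<bullet> d"
proof -
  have "((\<lambda>s. G (x + s *\<^sub>R d)) has_real_derivative D \<bullet> d) (at 0)"
    using G by (intro DERIV_along_line) simp
  then have "((\<lambda>t. (G (x + t *\<^sub>R d) - G x) / t) \<longlongrightarrow> D \<bullet> d) (at 0)"
    by (simp add: DERIV_def)
  then have "((\<lambda>t. (G (x + t *\<^sub>R d) - G x) / t) \<longlongrightarrow> D \<bullet> d) (at_right 0)"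
    by (rule filterlim_at_split[THEN iffD1, THEN conjunct2])
  moreover have "eventually (\<lambda>t. c \<le> (G (x + t *\<^sub>R d) - G x) / t) (at_right 0)"
    unfolding eventually_at_right_field
    using le by (intro exI[of _ 1]) (auto simp: field_simps)
  ultimately show ?thesis
    by (intro tendsto_lowerbound) auto
qed

lemma GDERIV_grad:
  fixes h :: "'a::euclidean_space \<Rightarrow> real"
  assumes "h differentiable (at x)"
  shows "GDERIV h x :> grad h x"
proof -
  obtain f' where f': "(h has_derivative f') (at x)"
    using assms by (auto simp: differentiable_def)
  then interpret bounded_linear f'
    by (rule has_derivative_bounded_linear)
  let ?D = "\<Sum>b\<in>Basis. f' b *\<^sub>R b"
  have "f' u = u \<bullet> ?D" for u
  proof -
    have "f' u = f' (\<Sum>b\<in>Basis. (u \<bullet> b) *\<^sub>R b)"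
      by (simp add: euclidean_representation)
    also have "\<dots> = u \<bullet> ?D"
      by (simp add: sum scaleR inner_sum_right mult.commute)
    finally show ?thesis .
  qed
  then have "f' = (\<lambda>u. u \<bullet> ?D)"
    by (rule ext)
  with f' have D: "GDERIV h x :> ?D"
    unfolding gderiv_def by metis
  have "D' = ?D" if "GDERIV h x :> D'" for D'
  proof -
    have "(\<lambda>u. u \<bullet> D') = (\<lambda>u. u \<bullet> ?D)"
      using that D unfolding gderiv_def by (rule has_derivative_unique)
    then have "\<And>u. u \<bullet> D' = u \<bullet> ?D"
      by meson
    then show ?thesis
      by (rule vector_eq_ldot[THEN iffD1, OF allI])
  qed
  then show ?thesis
    unfolding grad_def using D by (intro theI[of "\<lambda>D. GDERIV h x :> D"])
qed

text \<open>
  Along the segment from \<open>z\<close> to \<open>p\<close>, the difference of the two sides has a nonpositive derivative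
  by the Lipschitz bound on the gradient.
\<close>

lemma L_smooth_descent:
  fixes h :: "'a::euclidean_space \<Rightarrow> real"
  assumes "L_smooth L h"
  shows "h p \<le> h z + grad h z \<bullet> (p - z) + L / 2 * (norm (p - z))\<^sup>2"
proof -
  let ?d = "p - z"
  let ?e = "\<lambda>t. h (z + t *\<^sub>R ?d) - t * (grad h z \<bullet> ?d) - L / 2 * t\<^sup>2 * (norm ?d)\<^sup>2"
  let ?e' = "\<lambda>t. grad h (z + t *\<^sub>R ?d) \<bullet> ?d - grad h z \<bullet> ?d - L * t * (norm ?d)\<^sup>2"
  have h: "GDERIV h u :> grad h u" and lip: "L-lipschitz_on UNIV (grad h)" for u
    using assms by (auto simp: L_smooth_def intro: GDERIV_grad)
  have deriv: "(?e has_real_derivative ?e' t) (at t)" for t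
    by (rule derivative_eq_intros DERIV_along_line h refl | simp)+
  have "?e' t \<le> 0" if "0 \<le> t" for t
  proof -
    have "(grad h (z + t *\<^sub>R ?d) - grad h z) \<bullet> ?d \<le> norm (grad h (z + t *\<^sub>R ?d) - grad h z) * norm ?d"
      by (rule norm_cauchy_schwarz)
    also have "\<dots> \<le> (L * norm (t *\<^sub>R ?d)) * norm ?d"
      using lipschitz_onD[OF lip, of "z + t *\<^sub>R ?d" z]
      by (intro mult_right_mono) (auto simp: dist_norm)
    finally show ?thesis
      using that by (simp add: inner_diff_left power2_eq_square mult.assoc)
  qed
  then have "\<exists>e'. (?e has_real_derivative e') (at t) \<and> e' \<le> 0" if "0 \<le> t" for t
    using deriv that by blast
  then have "?e 1 \<le> ?e 0"
    by (intro DERIV_nonpos_imp_nonincreasing[of 0 1 ?e]) auto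
  then show ?thesis
    by simp
qed

lemma convex_above_tangent:
  fixes F :: "'a::euclidean_space \<Rightarrow> real"
  assumes conv: "convex_on UNIV F" and F: "GDERIV F z :> D"
  shows "F z + D \<bullet> (u - z) \<le> F u"
proof -
  have "GDERIV (\<lambda>x. - F x) z :> - D"
    using F by (rule GDERIV_minus)
  moreover have "t * (F z - F u) \<le> - F (z + t *\<^sub>R (u - z)) - - F z" if "0 < t" "t < 1" for t
  proof -
    have "F ((1 - t) *\<^sub>R z + t *\<^sub>R u) \<le> (1 - t) * F z + t * F u"
      using that by (intro convex_onD[OF conv]) auto
    moreover have "(1 - t) *\<^sub>R z + t *\<^sub>R u = z + t *\<^sub>R (u - z)"
      by (simp add: algebra_simps)
    ultimately show ?thesis
      by (simp add: algebra_simps)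
  qed
  ultimately have "F z - F u \<le> - D \<bullet> (u - z)"
    by (rule gderiv_inner_ge)
  then show ?thesis
    by simp
qed

lemma GDERIV_norm_squared:
  fixes x :: "'a::euclidean_space"
  shows "GDERIV (\<lambda>u. c / 2 * (norm (u - w))\<^sup>2) x :> c *\<^sub>R (x - w)"
proof -
  have "((\<lambda>u. c / 2 * ((u - w) \<bullet> (u - w))) has_derivative
      (\<lambda>u. c / 2 * ((x - w) \<bullet> u + u \<bullet> (x - w)))) (at x)"
    by (rule derivative_eq_intros refl | simp)+
  moreover have "(\<lambda>u. c / 2 * ((x - w) \<bullet> u + u \<bullet> (x - w))) = (\<lambda>u. u \<bullet> (c *\<^sub>R (x - w)))"
    by (intro ext) (simp add: inner_commute)
  ultimately show ?thesis
    unfolding gderiv_def power2_norm_eq_inner by metis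
qed

lemma strongly_convex_above_tangent:
  fixes h :: "'a::euclidean_space \<Rightarrow> real"
  assumes "strongly_convex mu h" and h: "GDERIV h z :> D"
  shows "h z + D \<bullet> (u - z) + mu / 2 * (norm (u - z))\<^sup>2 \<le> h u"
proof -
  have "GDERIV (\<lambda>x. h x - mu / 2 * (norm x)\<^sup>2) z :> D - mu *\<^sub>R z"
    using GDERIV_diff[OF h GDERIV_norm_squared[of mu 0 z]] by simp
  with assms(1) have "h z - mu / 2 * (norm z)\<^sup>2 + (D - mu *\<^sub>R z) \<bullet> (u - z) \<le> h u - mu / 2 * (norm u)\<^sup>2"
    unfolding strongly_convex_def by (rule convex_above_tangent)
  then show ?thesis
    unfolding power2_norm_eq_inner by (simp add: algebra_simps inner_commute)
qed

section \<open>Minimizing a smooth function plus a convex one\<close>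

text \<open>
  Moving from \<open>p\<close> a fraction \<open>t\<close> of the way to \<open>u\<close> raises \<open>psi\<close> by at most
  \<open>t * (psi u - psi p)\<close>, so minimality of \<open>p\<close> forces \<open>G\<close> to grow at rate at least
  \<open>psi p - psi u\<close>. Thus \<open>- D\<close> is a subgradient of \<open>psi\<close> at \<open>p\<close>. This is applied with \<open>G = h\<close> at
  the minimizer of the objective and with the quadratic model of \<open>h\<close> at a point of \<open>T_step\<close>.
\<close>

lemma convex_ext_optimality:
  fixes psi :: "'a::euclidean_space \<Rightarrow> ereal"
  assumes proper: "proper_ext psi" and conv: "convex_ext psi" and G: "GDERIV G p :> D"
    and min: "is_arg_min (\<lambda>x. ereal (G x) + psi x) (\<lambda>_. True) p"
  shows "\<bar>psi p\<bar> \<noteq> \<infinity>"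
    and "ereal (real_of_ereal (psi p) - D \<bullet> (u - p)) \<le> psi u"
proof -
  have min': "ereal (G p) + psi p \<le> ereal (G x) + psi x" for x
    using min by (auto simp: is_arg_min_def not_less)
  have ninf: "psi x \<noteq> -\<infinity>" for x
    using proper by (auto simp: proper_ext_def)
  obtain x1 where x1: "psi x1 \<noteq> \<infinity>"
    using proper by (auto simp: proper_ext_def)
  show fin: "\<bar>psi p\<bar> \<noteq> \<infinity>"
    using min'[of x1] x1 ninf[of p] ninf[of x1] by (cases "psi p"; cases "psi x1") auto
  show "ereal (real_of_ereal (psi p) - D \<bullet> (u - p)) \<le> psi u"
  proof (cases "psi u")
    case (real s)
    obtain r where r: "psi p = ereal r"
      using fin by (cases "psi p") auto
    have "t * (r - s) \<le> G (p + t *\<^sub>R (u - p)) - G p" if t: "0 < t" "t < 1" for t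
    proof -
      let ?w = "p + t *\<^sub>R (u - p)"
      have "?w = (1 - t) *\<^sub>R p + t *\<^sub>R u"
        by (simp add: algebra_simps)
      then have "psi ?w \<le> ereal (1 - t) * psi p + ereal t * psi u"
        using conv t unfolding convex_ext_def by metis
      also have "\<dots> = ereal ((1 - t) * r + t * s)"
        by (simp add: r real)
      finally have "ereal (G ?w) + psi ?w \<le> ereal (G ?w) + ereal ((1 - t) * r + t * s)"
        by (rule add_left_mono)
      with min'[of ?w] have "ereal (G p) + psi p \<le> ereal (G ?w) + ereal ((1 - t) * r + t * s)"
        by (rule order_trans)
      then have "G p + r \<le> G ?w + ((1 - t) * r + t * s)"
        by (simp add: r)
      then show ?thesis
        by (simp add: algebra_simps)
    qed
    then have "r - s \<le> D \<bullet> (u - p)"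
      by (rule gderiv_inner_ge[OF G])
    then show ?thesis
      by (simp add: r real)
  qed (use ninf in auto)
qed


lemma arg_min_is_arg_min: "is_arg_min f P w \<Longrightarrow> is_arg_min f P (arg_min f P)"
  unfolding arg_min_def by (rule someI)

text \<open>
  A strict lower bound on a lower semicontinuous function persists near the point, and so does a
  strict upper bound on a continuous one; a real number between the two sides of
  \<open>c - r x < psi x\<close> separates them.
\<close>

lemma lsc_ext_closed_sublevel:
  fixes psi :: "'a::topological_space \<Rightarrow> ereal"
  assumes lsc: "lsc_ext psi" and r: "continuous_on UNIV r"
  shows "closed {x. ereal (r x) + psi x \<le> ereal c}"
proof -
  have "open {x. ereal (c - r x) < psi x}"
  proof (subst open_subopen, safe)
    fix x assume "ereal (c - r x) < psi x"
    then obtain e where e: "ereal (c - r x) < ereal e" "ereal e < psi x"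
      using ereal_dense2 by blast
    have "ereal e < Liminf (at x) psi"
      using lsc e by (auto simp: lsc_ext_def intro: less_le_trans)
    then have "eventually (\<lambda>y. ereal e < psi y) (at x)"
      by (rule less_LiminfD)
    with e(2) have psi: "eventually (\<lambda>y. ereal e < psi y) (nhds x)"
      by (simp add: eventually_nhds_conv_at)
    have "((\<lambda>y. c - r y) \<longlongrightarrow> c - r x) (nhds x)"
      using r by (intro tendsto_diff tendsto_const)
        (simp add: continuous_on_def tendsto_at_iff_tendsto_nhds[symmetric])
    then have "eventually (\<lambda>y. c - r y < e) (nhds x)"
      by (rule order_tendstoD) (use e in simp)
    with psi have "eventually (\<lambda>y. ereal (c - r y) < psi y) (nhds x)"
      by eventually_elim (metis ereal_less_le less_ereal.simps(1) less_imp_le order_less_trans)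
    then show "\<exists>T. open T \<and> x \<in> T \<and> T \<subseteq> {x. ereal (c - r x) < psi x}"
      unfolding eventually_nhds by blast
  qed
  moreover have "{x. ereal (r x) + psi x \<le> ereal c} = - {x. ereal (c - r x) < psi x}"
  proof (intro set_eqI)
    fix x show "x \<in> {x. ereal (r x) + psi x \<le> ereal c} \<longleftrightarrow> x \<in> - {x. ereal (c - r x) < psi x}"
      by (cases "psi x") auto
  qed
  ultimately show ?thesis
    by (simp add: closed_def)
qed

text \<open>
  The sublevel sets at \<open>i + 1 / (n + 1)\<close>, with \<open>i\<close> the infimum, are compact, nonempty and nested;
  any point of their intersection is a minimizer.
\<close>

lemma attains_min_if_compact_sublevels:
  fixes q :: "'a::euclidean_space \<Rightarrow> ereal"
  assumes compact: "\<And>c. compact {x. q x \<le> ereal c}"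
    and below: "\<And>x. ereal B \<le> q x" and finite: "q w \<noteq> \<infinity>"
  shows "\<exists>p. is_arg_min q (\<lambda>_. True) p"
proof -
  have "ereal B \<le> (INF x. q x)" "(INF x. q x) \<le> q w"
    using below by (auto intro: INF_greatest INF_lower)
  then obtain i where i: "(INF x. q x) = ereal i"
    using finite by (cases "INF x. q x") auto
  define S where "S n = {x. q x \<le> ereal (i + 1 / real (Suc n))}" for n
  have "S n \<noteq> {}" for n
  proof -
    have "(INF x. q x) < ereal (i + 1 / real (Suc n))"
      by (simp add: i)
    then obtain x where "q x < ereal (i + 1 / real (Suc n))"
      by (auto simp: INF_less_iff)
    then show ?thesis
      unfolding S_def using less_imp_le by blast
  qed
  moreover have "S n \<subseteq> S k" if "k \<le> n" for k n
    using that by (auto simp: S_def frac_le elim!: order_trans)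
  ultimately have "\<Inter>(range S) \<noteq> {}"
    using compact by (intro compact_nest) (auto simp: S_def)
  then obtain p where p: "\<And>n. q p \<le> ereal (i + 1 / real (Suc n))"
    by (auto simp: S_def)
  have "(\<lambda>n. ereal (i + 1 / real (Suc n))) \<longlonglongrightarrow> ereal (i + 0)"
    by (intro tendsto_intros LIMSEQ_Suc lim_1_over_n)
  then have "q p \<le> ereal (i + 0)"
    by (rule tendsto_lowerbound) (simp_all add: p del: of_nat_Suc plus_ereal.simps)
  then have "q p \<le> q x" for x
    using INF_lower[of x UNIV q] i by auto
  then show ?thesis
    by (auto simp: is_arg_min_def not_less)
qed

text \<open>
  An affine minorant of \<open>psi\<close> is what makes the proximal objective coercive: the quadratic term
  dominates every linear one, so sublevel sets are bounded.
\<close>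

lemma T_step_is_arg_min:
  fixes psi :: "'a::euclidean_space \<Rightarrow> ereal"
  assumes L: "0 < L" and lsc: "lsc_ext psi" and w: "psi w \<noteq> \<infinity>"
    and minorant: "\<And>u. ereal (r + d \<bullet> u) \<le> psi u"
  shows "is_arg_min
    (\<lambda>x. ereal (h z + grad h z \<bullet> (x - z) + L / 2 * (norm (x - z))\<^sup>2) + psi x) (\<lambda>_. True)
    (T_step L h psi z)"
proof -
  let ?Q = "\<lambda>x. h z + grad h z \<bullet> (x - z) + L / 2 * (norm (x - z))\<^sup>2"
  let ?q = "\<lambda>x. ereal (?Q x) + psi x"
  define b where "b = grad h z + d"
  define B where "B = h z + r + d \<bullet> z - (norm b)\<^sup>2 / L"
  have coercive: "ereal (B + L / 4 * (norm (u - z))\<^sup>2) \<le> ?q u" for u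
  proof -
    have "- (b \<bullet> (u - z)) \<le> norm b * norm (u - z)"
      using norm_cauchy_schwarz[of "- b" "u - z"] by simp
    \<comment> \<open>Half of the quadratic term absorbs the linear term, the other half gives coercivity.\<close>
    moreover have "norm b * norm (u - z) \<le> (norm b)\<^sup>2 / L + L / 4 * (norm (u - z))\<^sup>2"
    proof -
      have "0 \<le> (L / 2 * norm (u - z) - norm b)\<^sup>2 / L"
        using L by simp
      also have "\<dots> = (norm b)\<^sup>2 / L + L / 4 * (norm (u - z))\<^sup>2 - norm b * norm (u - z)"
        using L by (simp add: field_simps power2_eq_square)
      finally show ?thesis by simp
    qed
    ultimately have "B + L / 4 * (norm (u - z))\<^sup>2 \<le> ?Q u + (r + d \<bullet> u)"
      unfolding B_def b_def by (simp add: algebra_simps inner_simps)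
    then have "ereal (B + L / 4 * (norm (u - z))\<^sup>2) \<le> ereal (?Q u) + ereal (r + d \<bullet> u)"
      by simp
    also have "\<dots> \<le> ?q u"
      using minorant by (rule add_left_mono)
    finally show ?thesis .
  qed
  have "compact {x. ?q x \<le> ereal c}" for c
  proof -
    have "{x. ?q x \<le> ereal c} \<subseteq> cball z (1 + 4 / L * (c - B))"
    proof
      fix u assume "u \<in> {x. ?q x \<le> ereal c}"
      then have "?q u \<le> ereal c"
        by simp
      with coercive[of u] have "ereal (B + L / 4 * (norm (u - z))\<^sup>2) \<le> ereal c"
        by (rule order_trans)
      then have "(norm (u - z))\<^sup>2 \<le> 4 / L * (c - B)"
        using L by (simp add: field_simps)
      moreover have "norm (u - z) \<le> 1 + (norm (u - z))\<^sup>2"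
        using zero_le_power2[of "norm (u - z) - 1"] norm_ge_zero[of "u - z"]
        unfolding power2_diff power_one by linarith
      ultimately show "u \<in> cball z (1 + 4 / L * (c - B))"
        by (simp add: dist_norm norm_minus_commute)
    qed
    moreover have "closed {x. ?q x \<le> ereal c}"
      by (intro lsc_ext_closed_sublevel lsc continuous_intros)
    ultimately show ?thesis
      using bounded_subset[OF bounded_cball] by (auto simp: compact_eq_bounded_closed)
  qed
  moreover have "ereal B \<le> ?q u" for u
    using L by (intro order_trans[OF _ coercive[of u]]) simp
  moreover have "?q w \<noteq> \<infinity>"
    using w by simp
  ultimately obtain p where "is_arg_min ?q (\<lambda>_. True) p"
    using attains_min_if_compact_sublevels[of ?q B w] by blast
  then show ?thesis
    unfolding T_step_def by (rule arg_min_is_arg_min)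
qed

text \<open>
  At a minimizer the gradient of \<open>h\<close> is the negative of a subgradient of \<open>psi\<close>, so in the sum of
  the two tangent inequalities only the quadratic term remains.
\<close>

lemma composite_growth:
  fixes psi :: "'a::euclidean_space \<Rightarrow> ereal"
  assumes h: "L_smooth L h" "strongly_convex mu h"
    and psi: "proper_ext psi" "convex_ext psi"
    and min: "is_arg_min (composite h psi) (\<lambda>_. True) p"
  shows "ereal (real_of_ereal (composite h psi p) + mu / 2 * (norm (u - p))\<^sup>2) \<le> composite h psi u"
proof -
  have G: "GDERIV h p :> grad h p"
    using h by (auto simp: L_smooth_def intro: GDERIV_grad)
  note opt = convex_ext_optimality[OF psi G min[unfolded composite_def[abs_def]]]
  obtain r where r: "psi p = ereal r"
    using opt(1) by (cases "psi p") auto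
  have "real_of_ereal (composite h psi p) + mu / 2 * (norm (u - p))\<^sup>2 \<le> h u + (r - grad h p \<bullet> (u - p))"
    using strongly_convex_above_tangent[OF h(2) G, of u] by (simp add: composite_def r)
  then have "ereal (real_of_ereal (composite h psi p) + mu / 2 * (norm (u - p))\<^sup>2)
      \<le> ereal (h u) + ereal (r - grad h p \<bullet> (u - p))"
    by simp
  also have "\<dots> \<le> composite h psi u"
    using opt(2)[of u] unfolding composite_def r by (intro add_left_mono) simp
  finally show ?thesis .
qed

text \<open>
  The optimality condition of the proximal subproblem says that \<open>g_map L h psi z - grad h z\<close> is a
  subgradient of \<open>psi\<close> at \<open>T_step L h psi z\<close>. The gradient of \<open>h\<close> cancels between this subgradient
  inequality and the strong convexity of \<open>h\<close> at \<open>z\<close>, and the descent lemma replaces \<open>h z\<close> by the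
  value at the new point. The minimizer \<open>xstar\<close> provides the affine minorant of \<open>psi\<close> that makes
  the subproblem solvable.
\<close>

lemma l_model_lower_bound:
  fixes psi :: "'a::euclidean_space \<Rightarrow> ereal"
  assumes L: "0 < L" and h: "L_smooth L h" "strongly_convex mu h"
    and psi: "proper_ext psi" "convex_ext psi" "lsc_ext psi"
    and min: "is_arg_min (composite h psi) (\<lambda>_. True) xstar"
  shows "psi (T_step L h psi z) \<noteq> \<infinity>"
    and "ereal (l_model L h psi u z + mu / 2 * (norm (u - z))\<^sup>2) \<le> composite h psi u"
proof -
  have G: "GDERIV h v :> grad h v" for v
    using h by (auto simp: L_smooth_def intro: GDERIV_grad)
  note opt = convex_ext_optimality[OF psi(1,2) G min[unfolded composite_def[abs_def]]]
  let ?p = "T_step L h psi z"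
  let ?g = "g_map L h psi z"
  have "ereal (real_of_ereal (psi xstar) + grad h xstar \<bullet> xstar + (- grad h xstar) \<bullet> u) \<le> psi u" for u
    using opt(2)[of u] by (simp add: inner_diff_right algebra_simps)
  moreover have "psi xstar \<noteq> \<infinity>"
    using opt(1) by auto
  ultimately have minp: "is_arg_min
      (\<lambda>x. ereal (h z + grad h z \<bullet> (x - z) + L / 2 * (norm (x - z))\<^sup>2) + psi x) (\<lambda>_. True) ?p"
    by (intro T_step_is_arg_min L psi)
  have "GDERIV (\<lambda>x. h z + grad h z \<bullet> (x - z)) ?p :> grad h z"
    unfolding gderiv_def by (auto intro!: derivative_eq_intros simp: inner_commute)
  from GDERIV_add[OF this GDERIV_norm_squared[of L z]]
  have D: "GDERIV (\<lambda>x. h z + grad h z \<bullet> (x - z) + L / 2 * (norm (x - z))\<^sup>2) ?p :> grad h z - ?g"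
    by (simp add: g_map_def algebra_simps)
  note optp = convex_ext_optimality[OF psi(1,2) D minp]
  show "psi ?p \<noteq> \<infinity>"
    using optp(1) by auto
  obtain r where r: "psi ?p = ereal r"
    using optp(1) by (cases "psi ?p") auto
  have p: "z - ?p = (1 / L) *\<^sub>R ?g"
    using L by (simp add: g_map_def)
  have "h ?p \<le> h z - grad h z \<bullet> (z - ?p) + L / 2 * (norm (z - ?p))\<^sup>2"
    using L_smooth_descent[OF h(1), of ?p z] by (simp add: inner_diff_right norm_minus_commute)
  also have "L / 2 * (norm (z - ?p))\<^sup>2 = 1 / (2 * L) * (norm ?g)\<^sup>2"
    unfolding p using L by (simp add: power_mult_distrib field_simps power2_eq_square)
  finally have descent: "h ?p \<le> h z - grad h z \<bullet> (z - ?p) + 1 / (2 * L) * (norm ?g)\<^sup>2" .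
  have "?g \<bullet> (u - ?p) = ?g \<bullet> (u - z) + ?g \<bullet> (z - ?p)"
    by (simp add: inner_diff_right)
  also have "?g \<bullet> (z - ?p) = 1 / L * (norm ?g)\<^sup>2"
    unfolding p by (simp add: power2_norm_eq_inner)
  finally have gp: "?g \<bullet> (u - ?p) = ?g \<bullet> (u - z) + 1 / L * (norm ?g)\<^sup>2" .
  have "1 / L * (norm ?g)\<^sup>2 = 2 * (1 / (2 * L) * (norm ?g)\<^sup>2)"
    by simp
  with descent gp have "l_model L h psi u z + mu / 2 * (norm (u - z))\<^sup>2
      \<le> h u + (r - (grad h z - ?g) \<bullet> (u - ?p))"
    using strongly_convex_above_tangent[OF h(2) G, of z u]
    by (simp add: l_model_def composite_def r inner_diff_left inner_diff_right)
  then have "ereal (l_model L h psi u z + mu / 2 * (norm (u - z))\<^sup>2)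
      \<le> ereal (h u) + ereal (r - (grad h z - ?g) \<bullet> (u - ?p))"
    by simp
  also have "\<dots> \<le> composite h psi u"
    using optp(2)[of u] unfolding composite_def r by (intro add_left_mono) simp
  finally show "ereal (l_model L h psi u z + mu / 2 * (norm (u - z))\<^sup>2) \<le> composite h psi u" .
qed

section \<open>Quadratic identities\<close>

text \<open>
  Writing \<open>w = v - z\<close> and \<open>q = u - z\<close>, the choice of \<open>z\<close> means \<open>y - z = - t *\<^sub>R w\<close>, so the linear
  term is \<open>t *\<^sub>R (q - (1 - t) *\<^sub>R w)\<close> paired with \<open>g\<close>. The two squared distances dominate the square
  of that same vector, and together with the square of \<open>g\<close> they complete a square. The factor
  \<open>L * t\<^sup>2\<close> will be the model curvature: this is where \<open>t = sqrt (mus k / L)\<close> comes from.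
\<close>

lemma momentum_step_nonneg:
  fixes g u v y z :: "'a::real_inner"
  assumes L: "0 < L" and t: "0 < t" "t < 1"
    and z: "z = (t / (1 + t)) *\<^sub>R v + (1 / (1 + t)) *\<^sub>R y"
  shows "0 \<le> 1 / (2 * L) * (norm g)\<^sup>2 + g \<bullet> ((1 - t) *\<^sub>R (y - z) + t *\<^sub>R (u - z))
    + L * t\<^sup>2 * ((1 - t) / 2 * (norm (u - v))\<^sup>2 + t / 2 * (norm (u - z))\<^sup>2)"
proof -
  define w q where "w = v - z" and "q = u - z"
  have "(1 + t) *\<^sub>R z = t *\<^sub>R v + y"
    unfolding z using t by (simp add: scaleR_add_right)
  then have y: "y - z = - t *\<^sub>R w"
    by (simp add: w_def algebra_simps)
  have s: "(1 - t) *\<^sub>R (y - z) + t *\<^sub>R (u - z) = t *\<^sub>R (q - (1 - t) *\<^sub>R w)"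
    unfolding y by (simp add: q_def algebra_simps)
  have "(norm (q - (1 - t) *\<^sub>R w))\<^sup>2 = (norm q)\<^sup>2 - 2 * (1 - t) * (q \<bullet> w) + (1 - t)\<^sup>2 * (norm w)\<^sup>2"
    unfolding power2_norm_eq_inner by (simp add: inner_simps inner_commute power2_eq_square algebra_simps)
  also have "\<dots> \<le> (norm q)\<^sup>2 - 2 * (1 - t) * (q \<bullet> w) + (1 - t) * (norm w)\<^sup>2"
    using t by (intro add_left_mono mult_right_mono) (auto simp: power2_eq_square mult_left_le)
  also have "\<dots> = (1 - t) * (norm (q - w))\<^sup>2 + t * (norm q)\<^sup>2"
    unfolding power2_norm_eq_inner by (simp add: inner_simps inner_commute algebra_simps)
  also have "q - w = u - v"
    by (simp add: q_def w_def)
  finally have p: "L * t\<^sup>2 / 2 * (norm (q - (1 - t) *\<^sub>R w))\<^sup>2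
      \<le> L * t\<^sup>2 / 2 * ((1 - t) * (norm (u - v))\<^sup>2 + t * (norm (u - z))\<^sup>2)"
    using L by (intro mult_left_mono) (auto simp: q_def)
  have square: "1 / (2 * L) * (norm (g + (L * t) *\<^sub>R p))\<^sup>2
      = 1 / (2 * L) * (norm g)\<^sup>2 + g \<bullet> (t *\<^sub>R p) + L * t\<^sup>2 / 2 * (norm p)\<^sup>2" for p
    unfolding power2_norm_eq_inner using L
    by (simp add: inner_simps inner_commute power2_eq_square field_simps)
  have "0 \<le> 1 / (2 * L) * (norm (g + (L * t) *\<^sub>R (q - (1 - t) *\<^sub>R w)))\<^sup>2"
    using L by simp
  also note square
  finally have "0 \<le> 1 / (2 * L) * (norm g)\<^sup>2 + g \<bullet> (t *\<^sub>R (q - (1 - t) *\<^sub>R w))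
      + L * t\<^sup>2 / 2 * (norm (q - (1 - t) *\<^sub>R w))\<^sup>2" .
  moreover have "L * t\<^sup>2 / 2 * ((1 - t) * (norm (u - v))\<^sup>2 + t * (norm (u - z))\<^sup>2)
      = L * t\<^sup>2 * ((1 - t) / 2 * (norm (u - v))\<^sup>2 + t / 2 * (norm (u - z))\<^sup>2)"
    by (simp add: field_simps)
  ultimately show ?thesis
    unfolding s using p by linarith
qed

lemma norm_squared_convex:
  fixes p q :: "'a::real_inner"
  assumes "0 \<le> s" "0 \<le> t" "s + t = 1"
  shows "(norm (s *\<^sub>R p + t *\<^sub>R q))\<^sup>2 \<le> s * (norm p)\<^sup>2 + t * (norm q)\<^sup>2"
proof -
  have t: "t = 1 - s"
    using assms by simp
  have "s * (norm p)\<^sup>2 + t * (norm q)\<^sup>2 - (norm (s *\<^sub>R p + t *\<^sub>R q))\<^sup>2 = s * t * (norm (p - q))\<^sup>2"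
    unfolding power2_norm_eq_inner t by (simp add: inner_simps inner_commute algebra_simps)
  moreover have "0 \<le> s * t * (norm (p - q))\<^sup>2"
    using assms by simp
  ultimately show ?thesis
    by linarith
qed

lemma norm_diff_squared_expand:
  fixes u w :: "'a::real_inner"
  shows "s / 2 * (norm (u - w))\<^sup>2 = s / 2 * (norm w)\<^sup>2 + (- s *\<^sub>R w) \<bullet> u + s / 2 * (norm u)\<^sup>2"
  unfolding power2_norm_eq_inner by (simp add: inner_simps inner_commute algebra_simps)

lemma quadratic_at_arg_min:
  fixes q :: "'a::real_inner \<Rightarrow> real"
  assumes q: "\<And>u. q u = c + b \<bullet> u + s / 2 * (norm u)\<^sup>2" and s: "0 < s"
    and p: "p = arg_min q (\<lambda>_. True)"
  shows "q u = q p + s / 2 * (norm (u - p))\<^sup>2"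
proof -
  define w where "w = (- 1 / s) *\<^sub>R b"
  have b: "b = - s *\<^sub>R w"
    using s by (simp add: w_def)
  have w: "q u = q w + s / 2 * (norm (u - w))\<^sup>2" for u
    unfolding q power2_norm_eq_inner b by (simp add: inner_simps inner_commute algebra_simps)
  have "q w \<le> q u" for u
    using w[of u] s by simp
  then have "is_arg_min q (\<lambda>_. True) w"
    by (simp add: is_arg_min_def not_less)
  then have "is_arg_min q (\<lambda>_. True) p"
    unfolding p arg_min_def by (rule someI)
  then have "q p \<le> q w"
    by (simp add: is_arg_min_def not_less)
  then have "s / 2 * (norm (p - w))\<^sup>2 \<le> 0"
    using w[of p] by linarith
  then have "p = w"
    using s by (simp add: mult_le_0_iff)
  then show ?thesis
    using w[of u] by simp
qed

section \<open>The weights of the algorithm\<close>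

locale adapt_apg_weights =
  fixes L mu :: real and mus a A :: "nat \<Rightarrow> real"
  assumes mu_pos: "0 < mu" and mu_le: "mu \<le> mus (Suc k)"
    and mus_dec: "decseq mus" and mus_less: "mus 1 < L"
    and A_0: "A 0 = 1"
    and a_Suc: "a (Suc k) = sqrt (mus (Suc k) / L) / (1 - sqrt (mus (Suc k) / L)) * A k"
    and A_Suc: "A (Suc k) = A k + a (Suc k)"
begin

definition theta :: "nat \<Rightarrow> real" where
  "theta k = sqrt (mus (Suc k) / L)"

lemma mus_pos: "0 < mus k"
  using mu_pos mu_le[of k] decseqD[OF mus_dec, of k "Suc k"] by simp

lemma L_pos: "0 < L"
  using mus_pos[of 1] mus_less by simp

lemma theta_pos: "0 < theta k"
  using mus_pos L_pos by (simp add: theta_def)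

lemma theta_less_1: "theta k < 1"
  using decseqD[OF mus_dec, of 1 "Suc k"] mus_less L_pos by (simp add: theta_def)

lemma theta_squared: "L * (theta k)\<^sup>2 = mus (Suc k)"
  using mus_pos[of "Suc k"] L_pos by (simp add: theta_def)

lemma a_Suc_theta: "a (Suc k) = theta k / (1 - theta k) * A k"
  using a_Suc by (simp add: theta_def)

text \<open>
  The form of the recursion in which \<open>theta k\<close> is the weight of the new minorant in the model.
\<close>

lemma A_eq: "A k = (1 - theta k) * A (Suc k)"
  using theta_less_1[of k] by (simp add: A_Suc a_Suc_theta field_simps)

lemma a_eq: "a (Suc k) = theta k * A (Suc k)"
  using A_Suc[of k] A_eq[of k] by (simp add: algebra_simps)

lemma A_pos: "0 < A k"
proof (induction k)
  case (Suc k)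
  then show ?case
    using A_eq[of k] theta_less_1[of k] by (simp add: zero_less_mult_iff)
qed (simp add: A_0)

lemma a_pos: "0 < a (Suc k)"
  using theta_pos A_pos by (simp add: a_eq)

lemma tau_eq: "a (Suc k) / A (Suc k) = theta k"
  using A_pos[of "Suc k"] by (simp add: a_eq)

lemma A_ge: "(1 - sqrt (mu / L)) powi (- int k) \<le> A k"
proof (induction k)
  case (Suc k)
  let ?r = "1 - sqrt (mu / L)"
  have "sqrt (mu / L) \<le> theta k"
    unfolding theta_def using mu_le L_pos by (simp add: divide_right_mono)
  then have r: "1 - theta k \<le> ?r" and r0: "0 < ?r"
    using theta_less_1[of k] by linarith+
  have "?r powi (- int (Suc k)) = ?r powi (- int k) / ?r"
    unfolding power_int_minus by (simp only: power_int_of_nat power_Suc inverse_mult_distrib divide_inverse mult.commute)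
  also have "\<dots> \<le> A k / ?r"
    using Suc r0 by (simp add: divide_right_mono)
  also have "\<dots> \<le> A (Suc k)"
    using mult_right_mono[OF r, of "A (Suc k)"] r0 A_pos[of "Suc k"]
    unfolding A_eq[of k] by (simp add: pos_divide_le_eq mult.commute)
  finally show ?case .
qed (simp add: A_0)

text \<open>
  The Hessian of the regularized model \<open>phi k\<close> defined below is \<open>sigma k\<close> times the identity.
\<close>

definition sigma :: "nat \<Rightarrow> real" where
  "sigma k = mus 0 + (\<Sum>i<k. a (Suc i) * mus (Suc i))"

lemma sigma_Suc: "sigma (Suc k) = sigma k + a (Suc k) * mus (Suc k)"
  by (simp add: sigma_def)

text \<open>
  All curvatures that enter \<open>sigma k\<close> are at least \<open>mus k\<close>, since \<open>mus\<close> does not increase, and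
  their weights sum to \<open>A k\<close>.
\<close>

lemma sigma_ge: "mus k * A k \<le> sigma k"
proof (induction k)
  case (Suc k)
  have "mus (Suc k) * A (Suc k) = mus (Suc k) * A k + a (Suc k) * mus (Suc k)"
    by (simp add: A_Suc algebra_simps)
  also have "mus (Suc k) * A k \<le> mus k * A k"
    using decseqD[OF mus_dec, of k "Suc k"] A_pos[of k] by (intro mult_right_mono) auto
  finally show ?case
    using Suc by (simp add: sigma_Suc)
qed (simp add: sigma_def A_0)

lemma sigma_ge_Suc: "mus (Suc k) * A k \<le> sigma k"
proof -
  have "mus (Suc k) * A k \<le> mus k * A k"
    using decseqD[OF mus_dec, of k "Suc k"] A_pos[of k] by (intro mult_right_mono) auto
  with sigma_ge show ?thesis
    by (rule order_trans[rotated])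
qed

lemma sigma_pos: "0 < sigma k"
  using sigma_ge[of k] mult_pos_pos[OF mus_pos[of k] A_pos[of k]] by linarith

end

section \<open>The estimate sequence and its perturbation\<close>

text \<open>
  The run in terms of a real-valued objective \<open>F\<close> on its domain \<open>D\<close>. Of the proximal step only the
  lower bound \<open>model\<close> is kept, and of the minimizer only the quadratic growth \<open>growth\<close>. The
  locale requires \<open>x0 \<in> D\<close>; starting points of infinite value are treated separately in the
  theorem.
\<close>

locale adapt_apg_run = adapt_apg_weights L mu mus a A
  for L mu :: real and mus a A :: "nat \<Rightarrow> real" +
  fixes F :: "'a::euclidean_space \<Rightarrow> real" and D :: "'a set" and T g :: "'a \<Rightarrow> 'a"
    and x0 xstar :: 'a and v x y :: "nat \<Rightarrow> 'a" and m :: "nat \<Rightarrow> 'a \<Rightarrow> real" and C :: real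
  assumes x0: "x0 \<in> D" and xstar: "xstar \<in> D" and T: "T z \<in> D"
    and growth: "u \<in> D \<Longrightarrow> F xstar + mu / 2 * (norm (u - xstar))\<^sup>2 \<le> F u"
    and model: "u \<in> D \<Longrightarrow> F (T z) + g z \<bullet> (u - z) + 1 / (2 * L) * (norm (g z))\<^sup>2
      + mu / 2 * (norm (u - z))\<^sup>2 \<le> F u"
    and mus_close: "mus (Suc k) - mu \<le> C / (real k + 2)\<^sup>2"
    and C_le: "C \<le> mu * (1 - sqrt (mus 0 / L)) / (3 * sqrt (mus 0 / L))"
    and y_0: "y 0 = x0" and y_Suc: "y (Suc k) = T (x (Suc k))"
    and v: "v k = arg_min (\<lambda>z. m k z + mus 0 / 2 * (norm (z - x0))\<^sup>2) (\<lambda>_. True)"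
    and x_Suc: "x (Suc k) = (a (Suc k) / A (Suc k) / (1 + a (Suc k) / A (Suc k))) *\<^sub>R v k
      + (1 / (1 + a (Suc k) / A (Suc k))) *\<^sub>R y k"
    and m_0: "m 0 u = F xstar"
    and m_Suc: "m (Suc k) u = m k u + a (Suc k) *
      (F (T (x (Suc k))) + g (x (Suc k)) \<bullet> (u - x (Suc k))
        + 1 / (2 * L) * (norm (g (x (Suc k))))\<^sup>2 + mus (Suc k) / 2 * (norm (u - x (Suc k)))\<^sup>2)"
begin

definition phi :: "nat \<Rightarrow> 'a \<Rightarrow> real" where
  "phi k u = m k u + mus 0 / 2 * (norm (u - x0))\<^sup>2"

lemma phi_0: "phi 0 u = F xstar + mus 0 / 2 * (norm (u - x0))\<^sup>2"
  by (simp add: phi_def m_0)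

lemma phi_Suc:
  "phi (Suc k) u = phi k u + a (Suc k) *
    (F (y (Suc k)) + g (x (Suc k)) \<bullet> (u - x (Suc k))
      + 1 / (2 * L) * (norm (g (x (Suc k))))\<^sup>2 + mus (Suc k) / 2 * (norm (u - x (Suc k)))\<^sup>2)"
  by (simp add: phi_def m_Suc y_Suc)

lemma y_in: "y k \<in> D"
  by (cases k) (simp_all add: y_0 x0 y_Suc T)

lemma phi_quadratic: "\<exists>c b. \<forall>u. phi k u = c + b \<bullet> u + sigma k / 2 * (norm u)\<^sup>2"
proof (induction k)
  case 0
  show ?case
    unfolding phi_0 norm_diff_squared_expand
    by (rule exI[of _ "F xstar + mus 0 / 2 * (norm x0)\<^sup>2"], rule exI[of _ "- mus 0 *\<^sub>R x0"])
      (simp add: sigma_def)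
next
  case (Suc k)
  then obtain c b where IH: "\<And>u. phi k u = c + b \<bullet> u + sigma k / 2 * (norm u)\<^sup>2"
    by blast
  let ?z = "x (Suc k)" and ?a = "a (Suc k)" and ?M = "mus (Suc k)"
  let ?c = "c + ?a * (F (y (Suc k)) - g ?z \<bullet> ?z + 1 / (2 * L) * (norm (g ?z))\<^sup>2 + ?M / 2 * (norm ?z)\<^sup>2)"
  let ?b = "b + ?a *\<^sub>R (g ?z - ?M *\<^sub>R ?z)"
  have "phi (Suc k) u = ?c + ?b \<bullet> u + sigma (Suc k) / 2 * (norm u)\<^sup>2" for u
    unfolding phi_Suc IH sigma_Suc norm_diff_squared_expand
    by (simp add: inner_simps algebra_simps add_divide_distrib)
  then show ?case
    by blast
qed

text \<open>
  Since \<open>v k\<close> minimizes the quadratic \<open>phi k\<close>, expanding about it leaves no linear term.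
\<close>

lemma phi_canonical: "phi k u = phi k (v k) + sigma k / 2 * (norm (u - v k))\<^sup>2"
proof -
  obtain c b where "\<And>u. phi k u = c + b \<bullet> u + sigma k / 2 * (norm u)\<^sup>2"
    using phi_quadratic by blast
  moreover have "v k = arg_min (phi k) (\<lambda>_. True)"
    unfolding v phi_def[abs_def] ..
  ultimately show ?thesis
    using sigma_pos by (intro quadratic_at_arg_min)
qed

text \<open>
  By induction: the hypothesis brings in \<open>F (y k)\<close>, which is bounded below by the new minorant at
  \<open>y k\<close>. What \<open>phi (Suc k) (v (Suc k))\<close> then has beyond the claimed bound is at least \<open>A (Suc k)\<close> times the
  expression of \<open>momentum_step_nonneg\<close>, whose weights \<open>1 - t\<close> and \<open>t\<close> are
  \<open>A k / A (Suc k)\<close> and \<open>a (Suc k) / A (Suc k)\<close>.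
  At \<open>k = 0\<close> the model is \<open>F xstar\<close> instead of \<open>F x0\<close>, whence the offset.
\<close>

lemma estimate_sequence: "A k * F (y k) - (F x0 - F xstar) \<le> phi k (v k)"
proof (induction k)
  case 0
  have "F xstar \<le> phi 0 (v 0)"
    using mus_pos[of 0] by (simp add: phi_0)
  then show ?case
    by (simp add: A_0 y_0)
next
  case (Suc k)
  define z u t A' M G f1 n where "z = x (Suc k)" and "u = v (Suc k)" and "t = theta k"
    and "A' = A (Suc k)" and "M = mus (Suc k)" and "G = g z" and "f1 = F (y (Suc k))"
    and "n = 1 / (2 * L) * (norm G)\<^sup>2"
  note defs = this
  have A: "A k = (1 - t) * A'" "a (Suc k) = t * A'" "0 < A'" and M: "M = L * t\<^sup>2"
    unfolding defs by (rule A_eq a_eq A_pos theta_squared[symmetric])+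
  have t: "0 < t" "t < 1"
    using theta_pos theta_less_1 by (auto simp: defs)
  have "0 \<le> mu / 2 * (norm (y k - z))\<^sup>2"
    using mu_pos by simp
  then have "f1 + G \<bullet> (y k - z) + n \<le> F (y k)"
    using model[OF y_in[of k], of z] unfolding defs y_Suc by linarith
  then have "(1 - t) * A' * (f1 + G \<bullet> (y k - z) + n) \<le> A k * F (y k)"
    unfolding A(1) using A(3) t by (intro mult_left_mono) auto
  with Suc have "(1 - t) * A' * (f1 + G \<bullet> (y k - z) + n) - (F x0 - F xstar) \<le> phi k (v k)"
    by linarith
  moreover have "M * ((1 - t) * A') / 2 * (norm (u - v k))\<^sup>2 \<le> sigma k / 2 * (norm (u - v k))\<^sup>2"
    using sigma_ge_Suc[of k] unfolding A(1) M_def[symmetric]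
    by (intro mult_right_mono divide_right_mono) auto
  ultimately have "(1 - t) * A' * (f1 + G \<bullet> (y k - z) + n) - (F x0 - F xstar)
      + M * ((1 - t) * A') / 2 * (norm (u - v k))\<^sup>2
      + t * A' * (f1 + G \<bullet> (u - z) + n + M / 2 * (norm (u - z))\<^sup>2) \<le> phi (Suc k) u"
    unfolding phi_Suc phi_canonical[of k u] A(2)
      z_def[symmetric] G_def[symmetric] M_def[symmetric] f1_def[symmetric] n_def[symmetric]
    by linarith
  moreover have "(1 - t) * A' * (f1 + G \<bullet> (y k - z) + n) - (F x0 - F xstar)
      + M * ((1 - t) * A') / 2 * (norm (u - v k))\<^sup>2
      + t * A' * (f1 + G \<bullet> (u - z) + n + M / 2 * (norm (u - z))\<^sup>2)
    = A' * f1 - (F x0 - F xstar) + A' * (n + G \<bullet> ((1 - t) *\<^sub>R (y k - z) + t *\<^sub>R (u - z))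
      + L * t\<^sup>2 * ((1 - t) / 2 * (norm (u - v k))\<^sup>2 + t / 2 * (norm (u - z))\<^sup>2))"
    unfolding M inner_add_right inner_scaleR_right by (simp add: field_simps)
  moreover have "0 \<le> A' * (n + G \<bullet> ((1 - t) *\<^sub>R (y k - z) + t *\<^sub>R (u - z))
      + L * t\<^sup>2 * ((1 - t) / 2 * (norm (u - v k))\<^sup>2 + t / 2 * (norm (u - z))\<^sup>2))"
    using A(3) momentum_step_nonneg[OF L_pos t, of z "v k" "y k" G u] x_Suc[of k]
    unfolding tau_eq by (simp add: z_def t_def G_def n_def)
  ultimately have "A' * f1 - (F x0 - F xstar) \<le> phi (Suc k) u"
    by linarith
  then show ?case
    by (simp add: defs)
qed

text \<open>
  The amount by which the models may overshoot the objective at \<open>xstar\<close>.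
\<close>

definition err :: "nat \<Rightarrow> real" where
  "err k = (\<Sum>i<k. a (Suc i) * ((mus (Suc i) - mu) / 2 * (norm (x (Suc i) - xstar))\<^sup>2))"

text \<open>
  At \<open>xstar\<close> each minorant with curvature \<open>mu\<close> is below \<open>F xstar\<close>; only the excess curvature
  \<open>mus (Suc i) - mu\<close> has to be paid for.
\<close>

lemma phi_at_xstar:
  "phi k xstar \<le> A k * F xstar + mus 0 / 2 * (norm (x0 - xstar))\<^sup>2 + err k"
proof (induction k)
  case 0
  show ?case
    by (simp add: phi_0 A_0 err_def norm_minus_commute)
next
  case (Suc k)
  let ?z = "x (Suc k)"
  have "F (y (Suc k)) + g ?z \<bullet> (xstar - ?z) + 1 / (2 * L) * (norm (g ?z))\<^sup>2
        + mus (Suc k) / 2 * (norm (xstar - ?z))\<^sup>2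
      \<le> F xstar + (mus (Suc k) - mu) / 2 * (norm (?z - xstar))\<^sup>2"
    using model[OF xstar, of ?z]
    by (simp add: y_Suc norm_minus_commute[of xstar] left_diff_distrib diff_divide_distrib)
  then have "phi (Suc k) xstar
      \<le> phi k xstar + a (Suc k) * (F xstar + (mus (Suc k) - mu) / 2 * (norm (?z - xstar))\<^sup>2)"
    unfolding phi_Suc using a_pos[of k] by (intro add_left_mono mult_left_mono) auto
  then show ?case
    using Suc by (simp add: err_def A_Suc distrib_left distrib_right)
qed

definition potential :: "nat \<Rightarrow> real" where
  "potential k = A k * (F (y k) - F xstar) + sigma k / 2 * (norm (v k - xstar))\<^sup>2"

definition start_gap :: real where
  "start_gap = F x0 - F xstar + mus 0 / 2 * (norm (x0 - xstar))\<^sup>2"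

text \<open>
  Combine the lower bound on \<open>phi k (v k)\<close> with the upper bound on \<open>phi k xstar\<close>; by
  \<open>phi_canonical\<close> the two model values differ by \<open>sigma k / 2 * (norm (v k - xstar))\<^sup>2\<close>.
\<close>

lemma potential_le: "potential k \<le> start_gap + err k"
  using estimate_sequence[of k] phi_at_xstar[of k] phi_canonical[of k xstar]
  by (simp add: potential_def start_gap_def algebra_simps norm_minus_commute)

lemma gap_ge: "mu / 2 * (norm (y k - xstar))\<^sup>2 \<le> F (y k) - F xstar"
  using growth[OF y_in[of k]] by simp

lemma gap_nonneg: "0 \<le> F (y k) - F xstar"
  using mu_pos by (intro order_trans[OF _ gap_ge]) simp

text \<open>
  The potential controls the distances that enter \<open>err\<close>: both \<open>v k\<close> and \<open>y k\<close> have a squared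
  distance to \<open>xstar\<close> bounded by their share of the potential, and \<open>x (Suc k)\<close> is a convex
  combination of them.
\<close>

lemma x_dist_le: "mu * A k / 2 * (norm (x (Suc k) - xstar))\<^sup>2 \<le> potential k"
proof -
  define s t where "s = theta k / (1 + theta k)" and "t = 1 / (1 + theta k)"
  have st: "0 \<le> s" "0 \<le> t" "s + t = 1"
    using theta_pos[of k] by (auto simp: s_def t_def field_simps)
  have x: "x (Suc k) - xstar = s *\<^sub>R (v k - xstar) + t *\<^sub>R (y k - xstar)"
    using x_Suc[of k] st(3) unfolding tau_eq s_def[symmetric] t_def[symmetric]
    by (simp add: algebra_simps) (metis scaleR_add_left scaleR_one)
  have V: "mu * A k / 2 * (norm (v k - xstar))\<^sup>2 \<le> sigma k / 2 * (norm (v k - xstar))\<^sup>2"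
  proof (intro mult_right_mono divide_right_mono)
    show "mu * A k \<le> sigma k"
      using sigma_ge_Suc[of k] mult_right_mono[OF mu_le[of k], of "A k"] A_pos[of k] by linarith
  qed auto
  have Y: "mu * A k / 2 * (norm (y k - xstar))\<^sup>2 \<le> A k * (F (y k) - F xstar)"
    using mult_left_mono[OF gap_ge[of k], of "A k"] A_pos[of k] by (simp add: algebra_simps)
  have "mu * A k / 2 * (norm (x (Suc k) - xstar))\<^sup>2
      \<le> mu * A k / 2 * (s * (norm (v k - xstar))\<^sup>2 + t * (norm (y k - xstar))\<^sup>2)"
    unfolding x using mu_pos A_pos[of k] st by (intro mult_left_mono norm_squared_convex) auto
  also have "\<dots> = s * (mu * A k / 2 * (norm (v k - xstar))\<^sup>2) + t * (mu * A k / 2 * (norm (y k - xstar))\<^sup>2)"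
    by (simp add: algebra_simps)
  also have "\<dots> \<le> s * (sigma k / 2 * (norm (v k - xstar))\<^sup>2) + t * (A k * (F (y k) - F xstar))"
    using V Y st by (intro add_mono mult_left_mono)
  also have "\<dots> \<le> 1 * (sigma k / 2 * (norm (v k - xstar))\<^sup>2) + 1 * (A k * (F (y k) - F xstar))"
    using st sigma_pos[of k] A_pos[of k] gap_nonneg[of k] by (intro add_mono mult_right_mono) auto
  finally show ?thesis
    by (simp add: potential_def)
qed

text \<open>
  The function \<open>(1 - t) / t\<close> decreases and \<open>theta k \<le> sqrt (mus 0 / L)\<close>, so the condition on \<open>C\<close>
  can be read with \<open>theta k\<close> in place of \<open>sqrt (mus 0 / L)\<close>.
\<close>

lemma weighted_perturbation_le:
  "theta k / (1 - theta k) * (mus (Suc k) - mu) \<le> mu / (3 * (real k + 2)\<^sup>2)"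
proof -
  define s where "s = sqrt (mus 0 / L)"
  let ?t = "theta k"
  have t: "0 < ?t" "?t < 1" "?t \<le> s"
    using theta_pos theta_less_1 decseqD[OF mus_dec, of 0 "Suc k"] L_pos
    by (auto simp: theta_def s_def divide_right_mono)
  have "C \<le> mu / 3 * (1 / s - 1)"
    using C_le t unfolding s_def[symmetric] by (simp add: field_simps)
  also have "\<dots> \<le> mu / 3 * (1 / ?t - 1)"
    using t mu_pos by (intro mult_left_mono diff_right_mono divide_left_mono) auto
  finally have C: "?t / (1 - ?t) * C \<le> mu / 3"
    using t by (simp add: field_simps)
  have "?t / (1 - ?t) * (mus (Suc k) - mu) \<le> ?t / (1 - ?t) * (C / (real k + 2)\<^sup>2)"
    using t mus_close by (intro mult_left_mono) auto
  also have "\<dots> = (?t / (1 - ?t) * C) / (real k + 2)\<^sup>2"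
    by simp
  also have "\<dots> \<le> mu / 3 / (real k + 2)\<^sup>2"
    using C by (intro divide_right_mono) auto
  finally show ?thesis
    by simp
qed

lemma err_increment_le: "err (Suc k) - err k \<le> potential k / (3 * (real k + 2)\<^sup>2)"
proof -
  let ?d = "(norm (x (Suc k) - xstar))\<^sup>2"
  have "err (Suc k) - err k = theta k / (1 - theta k) * (mus (Suc k) - mu) * (A k / 2 * ?d)"
    by (simp add: err_def a_Suc_theta)
  also have "\<dots> \<le> mu / (3 * (real k + 2)\<^sup>2) * (A k / 2 * ?d)"
    using weighted_perturbation_le A_pos[of k] by (intro mult_right_mono) auto
  also have "\<dots> = (mu * A k / 2 * ?d) / (3 * (real k + 2)\<^sup>2)"
    by simp
  also have "\<dots> \<le> potential k / (3 * (real k + 2)\<^sup>2)"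
    using x_dist_le by (intro divide_right_mono) auto
  finally show ?thesis .
qed

lemma start_gap_nonneg: "0 \<le> start_gap"
  using gap_nonneg[of 0] mus_pos[of 0] by (simp add: start_gap_def y_0)

text \<open>
  A discrete Gronwall argument in closed form. If the potential is at most \<open>2 * start_gap\<close>, the
  increment of \<open>err\<close> is at most \<open>2 / (3 * (k + 2)\<^sup>2)\<close> times \<open>start_gap\<close>, which is below the
  telescoping difference \<open>1 / (k + 1) - 1 / (k + 2)\<close> times \<open>start_gap\<close>; so the bound
  \<open>2 * start_gap\<close> is never exceeded.
\<close>

lemma err_bounded: "start_gap + err k \<le> (2 - 1 / (real k + 1)) * start_gap"
proof (induction k)
  case (Suc k)
  have "err (Suc k) - err k \<le> (2 * start_gap) / (3 * (real k + 2)\<^sup>2)"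
  proof -
    have "(2 - 1 / (real k + 1)) * start_gap \<le> 2 * start_gap"
      using start_gap_nonneg by (intro mult_right_mono) auto
    then have "potential k / (3 * (real k + 2)\<^sup>2) \<le> (2 * start_gap) / (3 * (real k + 2)\<^sup>2)"
      using potential_le[of k] Suc by (intro divide_right_mono) auto
    with err_increment_le[of k] show ?thesis
      by simp
  qed
  also have "\<dots> = 2 / (3 * (real k + 2)\<^sup>2) * start_gap"
    by simp
  also have "\<dots> \<le> (1 / (real k + 1) - 1 / (real k + 2)) * start_gap"
  proof (intro mult_right_mono start_gap_nonneg)
    have "1 / (real k + 1) - 1 / (real k + 2) = 1 / ((real k + 1) * (real k + 2))"
      by (simp add: field_simps)
    moreover have "2 / (3 * (real k + 2)\<^sup>2) \<le> 1 / ((real k + 1) * (real k + 2))"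
    proof -
      have "2 * ((real k + 1) * (real k + 2)) \<le> 1 * (3 * (real k + 2)\<^sup>2)"
        by (simp add: power2_eq_square algebra_simps)
      moreover have "0 < (real k + 1) * (real k + 2)" "0 < 3 * (real k + 2)\<^sup>2"
        by (auto intro!: mult_pos_pos)
      ultimately show ?thesis
        by (simp only: frac_le_eq divide_le_eq le_divide_eq pos_divide_le_eq) (simp add: field_simps)
    qed
    ultimately show "2 / (3 * (real k + 2)\<^sup>2) \<le> 1 / (real k + 1) - 1 / (real k + 2)"
      by simp
  qed
  finally have "err (Suc k) \<le> err k + (1 / (real k + 1) - 1 / (real k + 2)) * start_gap"
    by simp
  with Suc show ?case
    by (simp add: algebra_simps)
qed (simp add: err_def)

lemma objective_gap_le: "A k * (F (y k) - F xstar) \<le> 2 * start_gap"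
proof -
  have "A k * (F (y k) - F xstar) \<le> potential k"
    using sigma_pos[of k] by (simp add: potential_def)
  also have "\<dots> \<le> (2 - 1 / (real k + 1)) * start_gap"
    using potential_le[of k] err_bounded[of k] by simp
  also have "\<dots> \<le> 2 * start_gap"
    using start_gap_nonneg by (intro mult_right_mono) auto
  finally show ?thesis .
qed

end

section \<open>Convergence rate\<close>

theorem proposition2p8:
  fixes h :: "real ^ 'n \<Rightarrow> real" and psi f :: "real ^ 'n \<Rightarrow> ereal"
    and L mu C :: real and mus kappa a A tau :: "nat \<Rightarrow> real"
    and x0 xstar :: "real ^ 'n" and v x y :: "nat \<Rightarrow> real ^ 'n"
    and m :: "nat \<Rightarrow> real ^ 'n \<Rightarrow> real" and fstar :: real and C0 :: ereal
  assumes "0 < mu" and "mu \<le> L"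
    and "L_smooth L h" and "strongly_convex mu h"
    and "proper_ext psi" and "convex_ext psi" and "lsc_ext psi"
    and "f = composite h psi"
    and "is_arg_min f (\<lambda>_. True) xstar"
    and "fstar = real_of_ereal (f xstar)"
    and "decseq mus" and "\<forall>i. 0 < mus i" and "mus 1 < L"
    and "\<forall>k\<ge>1. 0 \<le> mus k - mu \<and> mus k - mu \<le> C / (real k + 1)\<^sup>2"
    and "C \<le> mu * (1 - sqrt (mus 0 / L)) / (3 * sqrt (mus 0 / L))"
    and "adapt_apg h psi fstar x0 L mus kappa v a A tau x y m"
    and "C0 = max (ereal ((mus 0 - mu) * (norm (x0 - xstar))\<^sup>2))
                  (2 * (f x0 - ereal fstar) + ereal (mu * (norm (x0 - xstar))\<^sup>2))"
  shows "(\<forall>k. f (y k) - ereal fstar \<le> 5 * C0 / ereal (2 * A k)) \<and>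
         (\<forall>k\<ge>1. A k \<ge> (1 - sqrt (mu / L)) powi (- int k))"
proof -
  note apg = assms(16)[unfolded adapt_apg_def]
  have L: "0 < L"
    using assms(1,2) by simp
  have kappa: "kappa k = mus (Suc k) / L" for k
    using apg by blast
  interpret weights: adapt_apg_weights L mu mus a A
  proof
    show "mu \<le> mus (Suc k)" for k
      using assms(14)[rule_format, of "Suc k"] by simp
    show "a (Suc k) = sqrt (mus (Suc k) / L) / (1 - sqrt (mus (Suc k) / L)) * A k" for k
      using apg unfolding kappa[symmetric] by blast
    show "A 0 = 1" "A (Suc k) = A k + a (Suc k)" for k
      using apg by blast+
  qed (use assms in auto)
  note min = assms(9)[unfolded assms(8)]
  note model = l_model_lower_bound[OF L assms(3-7) min, folded assms(8)]
  have f_ninf: "f u \<noteq> -\<infinity>" and f_inf: "f u = \<infinity> \<longleftrightarrow> psi u = \<infinity>" for u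
    using assms(5) by (auto simp: assms(8) composite_def proper_ext_def)
  define F where "F u = real_of_ereal (f u)" for u
  have f: "f u = ereal (F u)" if "f u \<noteq> \<infinity>" for u
    using that f_ninf[of u] by (cases "f u") (auto simp: F_def)
  have f_T: "f (T_step L h psi z) \<noteq> \<infinity>" for z
    using model(1)[of z] f_inf by simp
  have f_xstar: "f xstar \<noteq> \<infinity>"
  proof -
    obtain u where "psi u \<noteq> \<infinity>"
      using assms(5) by (auto simp: proper_ext_def)
    moreover have "f xstar \<le> f u"
      using assms(9) by (simp add: is_arg_min_def not_less)
    ultimately show ?thesis
      using f_inf[of u] by auto
  qed
  have F_xstar: "F xstar = fstar"
    by (simp add: F_def assms(10))
  have "f (y k) - ereal fstar \<le> 5 * C0 / ereal (2 * A k)" for k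
  proof (cases "f x0 = \<infinity>")
    case True
    then have "C0 = \<infinity>"
      by (simp add: assms(17) max_def)
    then show ?thesis
      using weights.A_pos[of k] by simp
  next
    case False
    interpret run: adapt_apg_run L mu mus a A F "{u. f u \<noteq> \<infinity>}" "T_step L h psi" "g_map L h psi"
      x0 xstar v x y m C
    proof
      show "x0 \<in> {u. f u \<noteq> \<infinity>}" "xstar \<in> {u. f u \<noteq> \<infinity>}" "T_step L h psi z \<in> {u. f u \<noteq> \<infinity>}" for z
        using False f_xstar f_T by auto
      show "F xstar + mu / 2 * (norm (u - xstar))\<^sup>2 \<le> F u" if "u \<in> {u. f u \<noteq> \<infinity>}" for u
        using composite_growth[OF assms(3-6) min, folded assms(8), of u] that
        by (simp add: f F_def[symmetric])
      show "F (T_step L h psi z) + g_map L h psi z \<bullet> (u - z) + 1 / (2 * L) * (norm (g_map L h psi z))\<^sup>2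
          + mu / 2 * (norm (u - z))\<^sup>2 \<le> F u" if "u \<in> {u. f u \<noteq> \<infinity>}" for u z
        using model(2)[of u z] that
        unfolding l_model_def assms(8)[symmetric] F_def[symmetric] by (simp add: f)
      show "mus (Suc k) - mu \<le> C / (real k + 2)\<^sup>2" for k
        using assms(14)[rule_format, of "Suc k"] by (simp add: add.commute)
      show "C \<le> mu * (1 - sqrt (mus 0 / L)) / (3 * sqrt (mus 0 / L))"
        by (rule assms)
      have a_0: "a 0 = 1"
        using apg by blast
      show "y 0 = x0" "y (Suc k) = T_step L h psi (x (Suc k))" for k
        using apg by blast+
      show "v k = arg_min (\<lambda>z. m k z + mus 0 / 2 * (norm (z - x0))\<^sup>2) (\<lambda>_. True)" for k
        using apg by (simp add: a_0)
      show "x (Suc k) = (a (Suc k) / A (Suc k) / (1 + a (Suc k) / A (Suc k))) *\<^sub>R v k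
          + (1 / (1 + a (Suc k) / A (Suc k))) *\<^sub>R y k" for k
        using apg by metis
      show "m 0 u = F xstar" for u
        using apg by (simp add: a_0 F_xstar)
      show "m (Suc k) u = m k u + a (Suc k) *
        (F (T_step L h psi (x (Suc k))) + g_map L h psi (x (Suc k)) \<bullet> (u - x (Suc k))
          + 1 / (2 * L) * (norm (g_map L h psi (x (Suc k))))\<^sup>2
          + mus (Suc k) / 2 * (norm (u - x (Suc k)))\<^sup>2)" for k u
      proof -
        have "m (Suc k) = (\<lambda>z. m k z + a (Suc k) *
            (l_model L h psi z (x (Suc k)) + mus (Suc k) / 2 * (norm (z - x (Suc k)))\<^sup>2))"
          using apg by blast
        then show ?thesis
          by (simp add: l_model_def F_def assms(8))
      qed
    qed
    let ?r = "(norm (x0 - xstar))\<^sup>2"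
    define c0 where "c0 = max ((mus 0 - mu) * ?r) (2 * (F x0 - fstar) + mu * ?r)"
    have C0: "C0 = ereal c0"
      using f[OF False] by (simp add: assms(17) c0_def numeral_eq_ereal)
    \<comment> \<open>\<open>start_gap\<close> is the mean of the two quantities under the maximum.\<close>
    have "2 * run.start_gap = (mus 0 - mu) * ?r + (2 * (F x0 - fstar) + mu * ?r)"
      unfolding run.start_gap_def F_xstar by (simp add: algebra_simps)
    also have "\<dots> \<le> 2 * c0"
      unfolding c0_def mult_2 by (intro add_mono max.cobounded1 max.cobounded2)
    finally have start: "2 * run.start_gap \<le> 2 * c0" .
    then have "A k * (F (y k) - fstar) \<le> 5 * c0 / 2"
      using run.objective_gap_le[of k] run.start_gap_nonneg F_xstar by simp
    then have "F (y k) - fstar \<le> 5 * c0 / (2 * A k)"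
      using weights.A_pos[of k] by (simp add: field_simps)
    moreover have "f (y k) = ereal (F (y k))"
      using run.y_in[of k] by (intro f) simp
    moreover have "5 * C0 / ereal (2 * A k) = ereal (5 * c0 / (2 * A k))"
      using weights.A_pos[of k] by (simp add: C0 numeral_eq_ereal)
    ultimately show ?thesis
      by simp
  qed
  then show ?thesis
    using weights.A_ge by blast
qed

end
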